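(* Let $H$ be a Hilbert space, let $A$ be the generator of a $C_0$-semigroup $(S(t))_{t\ge 0}$ on $H$ and let $M,\omega>0$ be constants with $\|S(t)\|\le Me^{-\omega t}$ for all $t\ge 0$. Let $B:H\to H$ be a continuous linear operator. Let $\bar\tau>0$, let $\tau:[0,+\infty)\to(0,+\infty)$ be a continuous function with $0\le\tau(t)\le\bar\tau$ for all $t\ge 0$, and let $k\in L^1_{loc}([-\bar\tau,+\infty);\mathbb{R})$ satisfy, for some $K>0$, $\int_{t-\bar\tau}^t|k(s)|\,ds\le K$ for all $t\ge 0$. Assume that there are constants $\gamma\ge 0$ and $\omega'\in[0,\omega)$ such that $$M\|B\|e^{\omega\bar\tau}\int_0^t|k(s)|\,ds\le\gamma+\omega' t\qquad\text{for all } t\ge 0.$$ Then for every $f\in C([-\bar\tau,0];H)$, with $U_0:=f(0)$, the solution $U\in C([0,+\infty);H)$ of $$U'(t)=AU(t)+k(t)BU(t-\tau(t)),\quad t\in(0,\infty),\qquad U(t)=f(t),\quad t\in[-\bar\tau,0],$$ satisfies $$\|U(t)\|\le Me^{\gamma}\Big(\|U_0\|+e^{\omega\bar\tau}K\|B\|\max_{s\in[-\bar\tau,0]}\|e^{\omega s}f(s)\|\Big)e^{-(\omega-\omega')t}\qquad\text{for all } t\ge 0.$$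
   Context: The solution of the problem with initial datum $f$ is understood in the weak (mild) sense: it is the continuous function $U:[-\bar\tau,+\infty)\to H$ with $U=f$ on $[-\bar\tau,0]$ and $$U(t)=S(t)U_0+\int_0^tS(t-s)\,k(s)BU(s-\tau(s))\,ds\qquad\text{for all } t\ge 0.$$ *)

theory Defs
  imports "HOL-Analysis.Analysis"
begin

text \<open>Only the values \<open>S t\<close> with \<open>t \<ge> 0\<close> matter.\<close>

definition C0_semigroup :: "(real \<Rightarrow> 'a::real_normed_vector \<Rightarrow>\<^sub>L 'a) \<Rightarrow> bool" where
  "C0_semigroup S \<longleftrightarrow>
     S 0 = id_blinfun \<and>
     (\<forall>s\<ge>0. \<forall>t\<ge>0. S (s + t) = S s o\<^sub>L S t) \<and>
     (\<forall>x. ((\<lambda>t. S t x) \<longlongrightarrow> x) (at_right 0))"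

text \<open>An unbounded operator is a partial function \<open>A\<close> with domain \<open>dom A\<close>; the
  domain of the generator consists of all \<open>x\<close> at which the limit exists.\<close>

definition generator_of :: "('a::real_normed_vector \<rightharpoonup> 'a) \<Rightarrow> (real \<Rightarrow> 'a \<Rightarrow>\<^sub>L 'a) \<Rightarrow> bool" where
  "generator_of A S \<longleftrightarrow>
     (\<forall>x y. A x = Some y \<longleftrightarrow> ((\<lambda>h. (S h x - x) /\<^sub>R h) \<longlongrightarrow> y) (at_right 0))"

definition L1_loc :: "real set \<Rightarrow> (real \<Rightarrow> real) \<Rightarrow> bool" where
  "L1_loc I k \<longleftrightarrow> (\<forall>C. compact C \<and> C \<subseteq> I \<longrightarrow> k absolutely_integrable_on C)"

text \<open>The mild form of \<open>U'(t) = A U(t) + k(t) B U(t - \<tau>(t))\<close>, \<open>U = f\<close> on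
  \<open>[-\<tau>bar, 0]\<close>, where \<open>A\<close> generates \<open>S\<close>. The integral is the gauge integral because
  the library's Bochner integral is restricted to separable spaces. For continuous
  \<open>U\<close> and \<open>\<tau>\<close> and locally integrable \<open>k\<close>, the integrand is the product of an integrable
  scalar function and a continuous one, hence Bochner integrable, and on such
  functions the two integrals agree.\<close>

definition mild_solution ::
    "(real \<Rightarrow> 'a::banach \<Rightarrow>\<^sub>L 'a) \<Rightarrow> ('a \<Rightarrow>\<^sub>L 'a) \<Rightarrow> (real \<Rightarrow> real) \<Rightarrow> (real \<Rightarrow> real) \<Rightarrow> real
      \<Rightarrow> (real \<Rightarrow> 'a) \<Rightarrow> (real \<Rightarrow> 'a) \<Rightarrow> bool" where
  "mild_solution S B k \<tau> \<tau>bar f U \<longleftrightarrow>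
     continuous_on {-\<tau>bar..} U \<and>
     (\<forall>t\<in>{-\<tau>bar..0}. U t = f t) \<and>
     (\<forall>t\<ge>0. (\<lambda>s. S (t - s) (k s *\<^sub>R B (U (s - \<tau> s)))) integrable_on {0..t} \<and>
        U t = S t (f 0) + integral {0..t} (\<lambda>s. S (t - s) (k s *\<^sub>R B (U (s - \<tau> s)))))"

end

theory Submission imports Defs begin

text \<open>Weighting by \<open>exp (\<omega> * t)\<close> turns the mild formula into
  \<open>exp (\<omega> * t) * norm (U t) \<le> P t\<close> with \<open>P\<close> nondecreasing. The delayed value at time \<open>s\<close> is
  bounded by \<open>P s\<close> if \<open>s - \<tau> s \<ge> 0\<close>, and by the maximum over the initial data otherwise; the
  latter happens only for \<open>s \<le> \<tau>bar\<close>, where the total mass of \<open>\<bar>k\<bar>\<close> is at most \<open>K\<close>.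
  Gronwall's inequality then bounds \<open>P\<close>.\<close>

section \<open>Gronwall's inequality for an integrable kernel\<close>

text \<open>The bound \<open>- x - 2 * x\<^sup>2 \<le> ln (1 - x)\<close> holds up to
  \<open>x = 1 / 2\<close>, and \<open>x \<le> e / 2\<close> lets the slack \<open>e * x\<close>
  absorb the quadratic term.\<close>

lemma exp_le_one_minus:
  fixes x e :: real
  assumes "0 \<le> x" "x \<le> 1 / 2" "x \<le> e / 2"
  shows "exp (- (1 + e) * x) \<le> 1 - x"
proof -
  have "x * x \<le> e / 2 * x"
    using assms by (intro mult_right_mono) auto
  then have "- (1 + e) * x \<le> - x - 2 * x\<^sup>2"
    by (simp add: algebra_simps power2_eq_square)
  also have "\<dots> \<le> ln (1 - x)"
    using assms by (intro ln_one_minus_pos_lower_bound) auto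
  finally show ?thesis
    using assms by (subst ln_ge_iff [symmetric]) auto
qed

text \<open>The kernel \<open>a\<close> is merely integrable, so \<open>exp (- integral {0..t} a)\<close> cannot be
  differentiated pointwise. Instead the right-hand side \<open>R\<close> is compared with
  \<open>exp ((1 + e) * integral {0..t} a)\<close> on the cells of a fine partition.\<close>

lemma gronwall_integrable_kernel:
  fixes a P :: "real \<Rightarrow> real"
  assumes T: "0 \<le> T"
    and a: "a integrable_on {0..T}" and a0: "\<And>t. t \<in> {0..T} \<Longrightarrow> 0 \<le> a t"
    and P0: "\<And>t. t \<in> {0..T} \<Longrightarrow> 0 \<le> P t"
    and aP: "(\<lambda>s. a s * P s) integrable_on {0..T}"
    and le: "\<And>t. t \<in> {0..T} \<Longrightarrow> P t \<le> C + integral {0..t} (\<lambda>s. a s * P s)"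
  shows "P T \<le> C * exp (integral {0..T} a)"
proof -
  define G where "G t = integral {0..t} a" for t
  define R where "R t = C + integral {0..t} (\<lambda>s. a s * P s)" for t
  have PR: "P t \<le> R t" if "t \<in> {0..T}" for t
    using le that by (simp add: R_def)
  have G_diff: "G t - G s = integral {s..t} a" if "0 \<le> s" "s \<le> t" "t \<le> T" for s t
    using Henstock_Kurzweil_Integration.integral_combine [OF that(1,2) integrable_subinterval_real [OF a]] that
    by (simp add: G_def)
  have R_diff: "R t - R s = integral {s..t} (\<lambda>s. a s * P s)" if "0 \<le> s" "s \<le> t" "t \<le> T" for s t
    using Henstock_Kurzweil_Integration.integral_combine [OF that(1,2) integrable_subinterval_real [OF aP]] that
    by (simp add: R_def)
  have R_mono: "R s \<le> R t" if "0 \<le> s" "s \<le> t" "t \<le> T" for s t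
  proof -
    have "0 \<le> integral {s..t} (\<lambda>s. a s * P s)"
      using that a0 P0 by (intro integral_nonneg integrable_subinterval_real [OF aP]) auto
    with R_diff [OF that] show ?thesis by simp
  qed
  \<comment> \<open>On the cell, \<open>P u \<le> R u \<le> R t\<close>, so \<open>R\<close> grows
    by at most \<open>(G t - G s) * R t\<close>. Using the right endpoint puts the factor
    \<open>1 - (G t - G s)\<close> on the left, where a lower bound by an exponential is
    wanted.\<close>
  have step: "R t * (1 - (G t - G s)) \<le> R s" if st: "0 \<le> s" "s \<le> t" "t \<le> T" for s t
  proof -
    have "integral {s..t} (\<lambda>s. a s * P s) \<le> integral {s..t} (\<lambda>u. a u * R t)"
    proof (rule integral_le)
      show "(\<lambda>s. a s * P s) integrable_on {s..t}"
        using st by (intro integrable_subinterval_real [OF aP]) auto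
      show "(\<lambda>u. a u * R t) integrable_on {s..t}"
        using st by (intro integrable_on_mult_left integrable_subinterval_real [OF a]) auto
      show "a u * P u \<le> a u * R t" if "u \<in> {s..t}" for u
        using that st PR [of u] R_mono [of u t] a0 [of u] by (intro mult_left_mono) auto
    qed
    also have "\<dots> = (G t - G s) * R t"
      using G_diff [OF st] by simp
    finally show ?thesis
      using R_diff [OF st] by (simp add: algebra_simps)
  qed
  \<comment> \<open>The extra \<open>e\<close> in the exponent pays for the second-order error on
    every cell, uniformly in the number of cells.\<close>
  have eps: "R T \<le> C * exp ((1 + e) * G T)" if e: "0 < e" for e
  proof -
    define h where "h t = R t * exp (- (1 + e) * G t)" for t
    have "uniformly_continuous_on {0..T} G"
      unfolding G_def
      by (intro compact_uniformly_continuous indefinite_integral_continuous_1 a) auto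
    \<comment> \<open>The two thresholds are the hypotheses of \<open>exp_le_one_minus\<close> for
      \<open>x = G t - G s\<close>.\<close>
    moreover have "0 < min (1 / 2) (e / 2)"
      using e by simp
    ultimately obtain d where d: "0 < d"
      and G_close: "\<And>s t. s \<in> {0..T} \<Longrightarrow> t \<in> {0..T} \<Longrightarrow> dist t s < d \<Longrightarrow>
        dist (G t) (G s) < min (1 / 2) (e / 2)"
      unfolding uniformly_continuous_on_def by metis
    have h_step: "h t \<le> h s" if st: "0 \<le> s" "s \<le> t" "t \<le> T" "t - s < d" for s t
    proof -
      have x0: "0 \<le> G t - G s"
        using G_diff [OF st(1-3)] st a0
        by (auto intro!: integral_nonneg integrable_subinterval_real [OF a])
      have "dist (G t) (G s) < min (1 / 2) (e / 2)"
        using st by (intro G_close) (auto simp: dist_real_def)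
      then have "exp (- (1 + e) * (G t - G s)) \<le> 1 - (G t - G s)"
        using x0 by (intro exp_le_one_minus) (auto simp: dist_real_def)
      \<comment> \<open>The lower bound for \<open>1 - (G t - G s)\<close> is about to be multiplied
        by \<open>R t\<close>, so the sign of \<open>R t\<close> matters.\<close>
      moreover have "0 \<le> R t"
        using PR [of t] P0 [of t] st by auto
      ultimately have "R t * exp (- (1 + e) * (G t - G s)) \<le> R s"
        using step [OF st(1-3)] by (meson mult_left_mono order_trans)
      then have "R t * exp (- (1 + e) * (G t - G s)) * exp (- (1 + e) * G s) \<le> h s"
        unfolding h_def by (intro mult_right_mono) auto
      then show ?thesis
        by (simp add: h_def mult.assoc algebra_simps flip: exp_add)
    qed
    \<comment> \<open>The strict inequality makes the cell width \<open>T / N\<close> smaller than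
      \<open>d\<close>, and forces \<open>N > 0\<close> even when \<open>T = 0\<close>.\<close>
    obtain N :: nat where N: "T / d < real N"
      using reals_Archimedean2 by blast
    have "0 \<le> T / d"
      using T d by simp
    then have N0: "0 < real N"
      using N by linarith
    have TN: "T / N < d"
      using N N0 d by (simp add: field_simps)
    \<comment> \<open>\<open>h\<close> does not increase from one grid point to the next;
      \<open>i = N\<close> gives \<open>h T \<le> h 0\<close>, and \<open>h 0 = C\<close> because
      both integrals vanish at \<open>0\<close>.\<close>
    have "h (real i * (T / N)) \<le> h 0" if "i \<le> N" for i
      using that
    proof (induction i)
      case 0
      then show ?case by simp
    next
      case (Suc i)
      have "real (Suc i) * T \<le> real N * T"
        using Suc.prems T by (intro mult_right_mono) auto
      then have "real (Suc i) * (T / N) \<le> T"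
        using N0 by (simp add: field_simps)
      moreover have "real (Suc i) * (T / N) = real i * (T / N) + T / N"
        by (simp add: distrib_right add_divide_distrib)
      moreover have "0 \<le> T / N" "0 \<le> real i * (T / N)"
        using T by simp_all
      ultimately have "h (real (Suc i) * (T / N)) \<le> h (real i * (T / N))"
        using TN by (intro h_step) linarith+
      with Suc show ?case by simp
    qed
    from this [of N] have "h T \<le> h 0"
      using N0 by simp
    then have "R T * exp (- (1 + e) * G T) * exp ((1 + e) * G T) \<le> C * exp ((1 + e) * G T)"
      unfolding h_def by (intro mult_right_mono) (auto simp: R_def G_def)
    moreover have "exp (- (1 + e) * G T) * exp ((1 + e) * G T) = 1"
      by (simp add: algebra_simps flip: exp_add)
    ultimately show ?thesis
      by (simp only: mult.assoc mult_1_right)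
  qed
  \<comment> \<open>Letting \<open>e\<close> tend to \<open>0\<close> from the right removes the
    slack.\<close>
  have "((\<lambda>e. C * exp ((1 + e) * G T)) \<longlongrightarrow> C * exp ((1 + 0) * G T)) (at_right 0)"
    by (intro tendsto_intros)
  then have "R T \<le> C * exp ((1 + 0) * G T)"
    by (rule tendsto_lowerbound)
      (use eventually_at_right_less [of 0] in \<open>auto elim!: eventually_mono intro: eps\<close>)
  with PR [of T] T show ?thesis
    by (simp add: G_def)
qed

section \<open>Integrability and cutoff of the kernel\<close>

text \<open>The cutoff reduces the domain to \<open>{0..min b t}\<close>, so for nonnegative
  \<open>q\<close> one bound serves all \<open>t\<close>, whether before or after
  \<open>b\<close>.\<close>

lemma integral_cutoff_le:
  fixes q :: "real \<Rightarrow> real"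
  assumes q: "q integrable_on {0..b}" and q0: "\<And>s. 0 \<le> s \<Longrightarrow> 0 \<le> q s"
  shows "(\<lambda>s. if s \<le> b then q s else 0) integrable_on {0..t}"
    and "integral {0..t} (\<lambda>s. if s \<le> b then q s else 0) \<le> integral {0..b} q"
proof -
  have int: "{..b} \<inter> {0..t} = {0..min b t}"
    by auto
  have q': "q integrable_on {0..min b t}"
    by (rule integrable_subinterval_real [OF q]) auto
  then show "(\<lambda>s. if s \<le> b then q s else 0) integrable_on {0..t}"
    using integrable_restrict_Int [of "{..b}" q "{0..t}"] int by simp
  have "integral {0..t} (\<lambda>s. if s \<le> b then q s else 0) = integral {0..min b t} q"
    using integral_restrict_Int [of "{0..t}" "{..b}" q] int by simp
  also have "\<dots> \<le> integral {0..b} q"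
    using q0 by (intro integral_subset_le q q') auto
  finally show "integral {0..t} (\<lambda>s. if s \<le> b then q s else 0) \<le> integral {0..b} q" .
qed

text \<open>Bridge from the Lebesgue integrals in the hypotheses on \<open>k\<close> to the gauge
  integrals used in the estimates.\<close>

lemma L1_loc_interval:
  assumes "L1_loc I k" "{a..b} \<subseteq> I"
  shows "k absolutely_integrable_on {a..b}"
    and "(\<lambda>s. \<bar>k s\<bar>) integrable_on {a..b}"
    and "(LINT s:{a..b}|lebesgue. \<bar>k s\<bar>) = integral {a..b} (\<lambda>s. \<bar>k s\<bar>)"
proof -
  show k: "k absolutely_integrable_on {a..b}"
    using assms by (auto simp: L1_loc_def)
  then have abs: "(\<lambda>s. \<bar>k s\<bar>) absolutely_integrable_on {a..b}"
    using absolutely_integrable_norm by (fastforce simp: o_def)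
  then show "(\<lambda>s. \<bar>k s\<bar>) integrable_on {a..b}"
    by (rule set_lebesgue_integral_eq_integral)
  show "(LINT s:{a..b}|lebesgue. \<bar>k s\<bar>) = integral {a..b} (\<lambda>s. \<bar>k s\<bar>)"
    by (rule set_lebesgue_integral_eq_integral [OF abs])
qed

lemma integrable_on_abs_mult_continuous:
  fixes k g :: "real \<Rightarrow> real"
  assumes k: "k absolutely_integrable_on {a..b}" and g: "continuous_on {a..b} g"
  shows "(\<lambda>s. \<bar>k s\<bar> * g s) integrable_on {a..b}"
proof -
  have "(\<lambda>s. \<bar>k s\<bar>) absolutely_integrable_on {a..b}"
    using absolutely_integrable_norm [OF k] by (simp add: o_def)
  moreover have "g \<in> borel_measurable (lebesgue_on {a..b})"
    by (intro continuous_imp_measurable_on_sets_lebesgue g) auto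
  moreover have "bounded (g ` {a..b})"
    by (intro compact_imp_bounded compact_continuous_image g) auto
  ultimately have "(\<lambda>s. g s * \<bar>k s\<bar>) absolutely_integrable_on {a..b}"
    by (intro absolutely_integrable_bounded_measurable_product_real) auto
  then show ?thesis
    by (simp add: mult.commute set_lebesgue_integral_eq_integral)
qed

section \<open>The exponentially weighted mild formula\<close>

text \<open>The decay factor of \<open>S (t - s)\<close> splits into
  \<open>exp (- \<omega> * t)\<close> and \<open>exp (\<omega> * s)\<close>. The weight cancels the
  first, so \<open>t\<close> survives only as the upper limit of integration and the bound is
  monotone in \<open>t\<close>.\<close>

lemma mild_solution_weighted_bound:
  assumes U: "mild_solution S B k \<tau> \<tau>bar f U"
    and S: "\<forall>t\<ge>0. norm (S t) \<le> M * exp (- \<omega> * t)"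
    and t: "0 \<le> t"
    and int: "(\<lambda>s. \<bar>k s\<bar> * (exp (\<omega> * s) * norm (U (s - \<tau> s)))) integrable_on {0..t}"
  shows "exp (\<omega> * t) * norm (U t) \<le>
    M * norm (f 0) +
    M * norm B * integral {0..t} (\<lambda>s. \<bar>k s\<bar> * (exp (\<omega> * s) * norm (U (s - \<tau> s))))"
    (is "_ \<le> _ + _ * integral _ ?p")
proof -
  let ?v = "\<lambda>s. S (t - s) (k s *\<^sub>R B (U (s - \<tau> s)))"
  let ?c = "M * norm B * exp (- \<omega> * t)"
  have v: "?v integrable_on {0..t}" and Ut: "U t = S t (f 0) + integral {0..t} ?v"
    using U t by (auto simp: mild_solution_def)
  \<comment> \<open>At time \<open>0\<close> the semigroup bound reads
    \<open>norm (S 0) \<le> M\<close>.\<close>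
  have M0: "0 \<le> M"
    using S [rule_format, of 0] norm_ge_zero [of "S 0"] by (simp del: norm_ge_zero)
  have "norm (integral {0..t} ?v) \<le> integral {0..t} (\<lambda>s. ?c * ?p s)"
  proof (rule integral_norm_bound_integral [OF v])
    show "(\<lambda>s. ?c * ?p s) integrable_on {0..t}"
      using int by (rule integrable_on_mult_right)
    show "norm (?v s) \<le> ?c * ?p s" if s: "s \<in> {0..t}" for s
    proof -
      have "norm (?v s) \<le> norm (S (t - s)) * norm (k s *\<^sub>R B (U (s - \<tau> s)))"
        by (rule norm_blinfun)
      also have "\<dots> \<le> (M * exp (- \<omega> * (t - s))) * (\<bar>k s\<bar> * (norm B * norm (U (s - \<tau> s))))"
        using S s M0 by (intro mult_mono) (auto intro!: mult_left_mono norm_blinfun)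
      also have "exp (- \<omega> * (t - s)) = exp (- \<omega> * t) * exp (\<omega> * s)"
        by (simp add: algebra_simps flip: exp_add)
      finally show ?thesis
        by (simp add: mult_ac)
    qed
  qed
  also have "\<dots> = ?c * integral {0..t} ?p"
    by simp
  finally have I: "norm (integral {0..t} ?v) \<le> ?c * integral {0..t} ?p" .
  have "norm (S t (f 0)) \<le> M * exp (- \<omega> * t) * norm (f 0)"
    using norm_blinfun [of "S t" "f 0"] S t
    by (meson mult_right_mono norm_ge_zero order_trans)
  with I have "norm (U t) \<le> M * exp (- \<omega> * t) * norm (f 0) + ?c * integral {0..t} ?p"
    unfolding Ut using norm_triangle_ineq [of "S t (f 0)" "integral {0..t} ?v"] by linarith
  then have "exp (\<omega> * t) * norm (U t) \<le>
      exp (\<omega> * t) * (M * exp (- \<omega> * t) * norm (f 0) + ?c * integral {0..t} ?p)"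
    by (intro mult_left_mono) auto
  also have "\<dots> = (exp (\<omega> * t) * exp (- \<omega> * t)) *
      (M * norm (f 0) + M * norm B * integral {0..t} ?p)"
    by (simp only: algebra_simps)
  also have "exp (\<omega> * t) * exp (- \<omega> * t) = 1"
    by (simp flip: exp_add)
  finally show ?thesis
    by simp
qed

section \<open>The decay estimate\<close>

theorem theorem3p1:
  fixes A :: "'a::{real_inner, banach} \<rightharpoonup> 'a"
    and S :: "real \<Rightarrow> 'a \<Rightarrow>\<^sub>L 'a"
    and B :: "'a \<Rightarrow>\<^sub>L 'a"
    and M \<omega> \<tau>bar K \<gamma> \<omega>' :: real
    and \<tau> k :: "real \<Rightarrow> real"
    and f U :: "real \<Rightarrow> 'a"
  assumes "C0_semigroup S" and "generator_of A S"
    and "M > 0" and "\<omega> > 0"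
    and "\<forall>t\<ge>0. norm (S t) \<le> M * exp (- \<omega> * t)"
    and "\<tau>bar > 0"
    and "continuous_on {0..} \<tau>"
    and "\<forall>t\<ge>0. 0 < \<tau> t \<and> \<tau> t \<le> \<tau>bar"
    and "L1_loc {-\<tau>bar..} k"
    and "K > 0"
    and "\<forall>t\<ge>0. (LINT s:{t - \<tau>bar..t}|lebesgue. \<bar>k s\<bar>) \<le> K"
    and "\<gamma> \<ge> 0" and "0 \<le> \<omega>'" and "\<omega>' < \<omega>"
    and "\<forall>t\<ge>0. M * norm B * exp (\<omega> * \<tau>bar) * (LINT s:{0..t}|lebesgue. \<bar>k s\<bar>) \<le> \<gamma> + \<omega>' * t"
    and "continuous_on {-\<tau>bar..0} f"
    and "mild_solution S B k \<tau> \<tau>bar f U"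
  shows "\<forall>t\<ge>0. norm (U t) \<le>
    M * exp \<gamma> *
      (norm (f 0) + exp (\<omega> * \<tau>bar) * K * norm B * (SUP s\<in>{-\<tau>bar..0}. norm (exp (\<omega> * s) *\<^sub>R f s)))
      * exp (- (\<omega> - \<omega>') * t)"
proof (intro allI impI)
  fix T :: real
  assume T: "0 \<le> T"
  note M = assms(3) and \<omega> = assms(4) and S = assms(5) and \<tau>bar = assms(6) and \<tau> = assms(8)
    and k = assms(9) and sol = assms(17)
  define F where "F = (SUP s\<in>{-\<tau>bar..0}. norm (exp (\<omega> * s) *\<^sub>R f s))"
  define g where "g s = exp (\<omega> * s) * norm (U (s - \<tau> s))" for s
  define P where "P t = M * norm (f 0) + M * norm B * integral {0..t} (\<lambda>s. \<bar>k s\<bar> * g s)" for t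
  define E where "E = exp (\<omega> * \<tau>bar)"
  \<comment> \<open>The Gronwall kernel; \<open>E\<close> bounds the cost of moving the weight from
    \<open>s - \<tau> s\<close> to \<open>s\<close>.\<close>
  define a where "a s = M * norm B * E * \<bar>k s\<bar>" for s
  define C where "C = M * (norm (f 0) + E * K * norm B * F)"

  have bdd: "bdd_above ((\<lambda>s. norm (exp (\<omega> * s) *\<^sub>R f s)) ` {-\<tau>bar..0})"
    by (intro bounded_imp_bdd_above compact_imp_bounded compact_continuous_image
        continuous_intros assms) auto
  have F: "exp (\<omega> * s) * norm (U s) \<le> F" if "s \<in> {-\<tau>bar..0}" for s
    using cSUP_upper [OF that bdd] sol that by (simp add: F_def mild_solution_def)
  have F0: "0 \<le> F"
    using F [of 0] \<tau>bar by (auto intro: order_trans [rotated])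
  have E0: "0 \<le> E"
    by (simp add: E_def)

  have "continuous_on {0..} (\<lambda>s. U (s - \<tau> s))"
  proof (rule continuous_on_compose2 [of "{-\<tau>bar..}" U])
    show "continuous_on {-\<tau>bar..} U"
      using sol by (simp add: mild_solution_def)
    show "continuous_on {0..} (\<lambda>s. s - \<tau> s)"
      by (intro continuous_intros assms)
    show "(\<lambda>s. s - \<tau> s) ` {0..} \<subseteq> {-\<tau>bar..}"
      using \<tau> by force
  qed
  then have "continuous_on {0..} g"
    unfolding g_def by (intro continuous_intros)
  then have kg: "(\<lambda>s. \<bar>k s\<bar> * g s) integrable_on {0..t}" for t
    using \<tau>bar
    by (intro integrable_on_abs_mult_continuous L1_loc_interval [OF k])
      (auto intro: continuous_on_subset)
  have ak: "(\<lambda>s. \<bar>k s\<bar>) integrable_on {0..t}" for t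
    using \<tau>bar by (intro L1_loc_interval [OF k]) auto
  have g0: "0 \<le> g s" for s
    by (simp add: g_def)
  have U_le: "exp (\<omega> * t) * norm (U t) \<le> P t" if "0 \<le> t" for t
    using mild_solution_weighted_bound [OF sol S that] kg [of t] by (simp add: P_def g_def)
  \<comment> \<open>No sign of \<open>s\<close> or \<open>t\<close> is required: for a negative
    upper limit the interval is empty and the integral is \<open>0\<close>.\<close>
  have P_mono: "P s \<le> P t" if "s \<le> t" for s t
    unfolding P_def using M that g0
    by (intro add_left_mono mult_left_mono integral_subset_le kg) auto
  have P0: "0 \<le> P t" for t
    unfolding P_def using M g0
    by (intro add_nonneg_nonneg mult_nonneg_nonneg integral_nonneg kg) auto
  \<comment> \<open>If \<open>s - \<tau> s < 0\<close>, then
    \<open>s < \<tau> s \<le> \<tau>bar\<close>, so the cutoff term \<open>F\<close> is present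
    exactly when the initial data may be reached. Both summands are nonnegative, so each case can
    bound by the sum.\<close>
  have g_le: "g s \<le> E * ((if s \<le> \<tau>bar then F else 0) + P s)" if s: "0 \<le> s" for s
  proof -
    have \<tau>s: "0 < \<tau> s" "\<tau> s \<le> \<tau>bar"
      using \<tau> s by auto
    have "exp (\<omega> * (s - \<tau> s)) * norm (U (s - \<tau> s)) \<le> (if s \<le> \<tau>bar then F else 0) + P s"
    proof (cases "0 \<le> s - \<tau> s")
      case True
      then show ?thesis
        using U_le [OF True] P_mono [of "s - \<tau> s" s] \<tau>s F0 by auto
    next
      case False
      then show ?thesis
        using F [of "s - \<tau> s"] P0 [of s] \<tau>s s by auto
    qed
    then have "exp (\<omega> * \<tau> s) * (exp (\<omega> * (s - \<tau> s)) * norm (U (s - \<tau> s))) \<le>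
        E * ((if s \<le> \<tau>bar then F else 0) + P s)"
      unfolding E_def using \<tau>s \<omega> by (intro mult_mono) auto
    moreover have "exp (\<omega> * s) = exp (\<omega> * \<tau> s) * exp (\<omega> * (s - \<tau> s))"
      by (simp add: algebra_simps flip: exp_add)
    ultimately show ?thesis
      by (simp add: g_def mult.assoc)
  qed

  have "continuous_on {0..t} (\<lambda>t. integral {0..t} (\<lambda>s. \<bar>k s\<bar> * g s))" for t
    by (rule indefinite_integral_continuous_1 [OF kg])
  then have "continuous_on {0..t} P" for t
    unfolding P_def by (intro continuous_intros)
  then have kP: "(\<lambda>s. \<bar>k s\<bar> * P s) integrable_on {0..t}" for t
    using \<tau>bar by (intro integrable_on_abs_mult_continuous L1_loc_interval [OF k]) auto
  have aP: "(\<lambda>s. a s * P s) integrable_on {0..t}" for t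
    using integrable_on_mult_right [OF kP, of "M * norm B * E"] by (simp add: a_def mult.assoc)
  define \<kappa> where "\<kappa> s = (if s \<le> \<tau>bar then \<bar>k s\<bar> else 0)" for s
  have \<kappa>: "\<kappa> integrable_on {0..t}" "integral {0..t} \<kappa> \<le> K" for t
  proof -
    show "\<kappa> integrable_on {0..t}"
      unfolding \<kappa>_def by (rule integral_cutoff_le [OF ak]) auto
    have "integral {0..t} \<kappa> \<le> integral {0..\<tau>bar} (\<lambda>s. \<bar>k s\<bar>)"
      unfolding \<kappa>_def by (rule integral_cutoff_le [OF ak]) auto
    also have "\<dots> = (LINT s:{0..\<tau>bar}|lebesgue. \<bar>k s\<bar>)"
      using \<tau>bar by (intro L1_loc_interval(3) [OF k, symmetric]) auto
    \<comment> \<open>For \<open>t = \<tau>bar\<close> the sliding window of the hypothesis is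
      \<open>{0..\<tau>bar}\<close>.\<close>
    also have "\<dots> \<le> K"
      using assms(11) [rule_format, of \<tau>bar] \<tau>bar by simp
    finally show "integral {0..t} \<kappa> \<le> K" .
  qed
  \<comment> \<open>Integrating \<open>g_le\<close> against \<open>\<bar>k s\<bar>\<close>, the
    history part contributes at most \<open>E * F * K\<close>, which goes into \<open>C\<close>; the
    rest is the Gronwall integral.\<close>
  have P_le: "P t \<le> C + integral {0..t} (\<lambda>s. a s * P s)" for t
  proof -
    have "integral {0..t} (\<lambda>s. \<bar>k s\<bar> * g s) \<le>
        integral {0..t} (\<lambda>s. E * F * \<kappa> s + E * (\<bar>k s\<bar> * P s))"
    proof (rule integral_le [OF kg])
      show "(\<lambda>s. E * F * \<kappa> s + E * (\<bar>k s\<bar> * P s)) integrable_on {0..t}"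
        by (intro integrable_add integrable_on_mult_right \<kappa> kP)
      show "\<bar>k s\<bar> * g s \<le> E * F * \<kappa> s + E * (\<bar>k s\<bar> * P s)" if "s \<in> {0..t}" for s
        using mult_left_mono [OF g_le [of s], of "\<bar>k s\<bar>"] that
        by (simp add: \<kappa>_def algebra_simps split: if_splits)
    qed
    also have "\<dots> = E * F * integral {0..t} \<kappa> + E * integral {0..t} (\<lambda>s. \<bar>k s\<bar> * P s)"
      by (subst integral_add) (auto intro!: integrable_on_mult_right \<kappa> kP)
    also have "\<dots> \<le> E * F * K + E * integral {0..t} (\<lambda>s. \<bar>k s\<bar> * P s)"
      using \<kappa>(2) [of t] E0 F0 by (intro add_right_mono mult_left_mono) auto
    finally have "P t \<le> M * norm (f 0) +
        M * norm B * (E * F * K + E * integral {0..t} (\<lambda>s. \<bar>k s\<bar> * P s))"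
      unfolding P_def using M by (intro add_left_mono mult_left_mono) auto
    also have "\<dots> = C + M * norm B * E * integral {0..t} (\<lambda>s. \<bar>k s\<bar> * P s)"
      by (simp add: C_def algebra_simps)
    also have "M * norm B * E * integral {0..t} (\<lambda>s. \<bar>k s\<bar> * P s) =
        integral {0..t} (\<lambda>s. a s * P s)"
      by (simp add: a_def mult.assoc)
    finally show ?thesis .
  qed

  have "exp (\<omega> * T) * norm (U T) \<le> P T"
    by (rule U_le [OF T])
  also have "P T \<le> C * exp (integral {0..T} a)"
  proof (rule gronwall_integrable_kernel [OF T _ _ _ aP P_le])
    show "a integrable_on {0..T}"
      unfolding a_def by (intro integrable_on_mult_right ak)
    show "0 \<le> a t" for t
      using M E0 by (simp add: a_def)
  qed (rule P0)
  also have "\<dots> \<le> C * exp (\<gamma> + \<omega>' * T)"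
  proof -
    have "integral {0..T} a = M * norm B * exp (\<omega> * \<tau>bar) * (LINT s:{0..T}|lebesgue. \<bar>k s\<bar>)"
      using \<tau>bar by (subst L1_loc_interval(3) [OF k]) (auto simp: a_def [abs_def] E_def)
    also have "\<dots> \<le> \<gamma> + \<omega>' * T"
      using assms(15) T by blast
    finally have "integral {0..T} a \<le> \<gamma> + \<omega>' * T" .
    \<comment> \<open>This sign allows the exponent to be enlarged under the factor
      \<open>C\<close>.\<close>
    moreover have "0 \<le> C"
      using M E0 F0 assms(10) by (simp add: C_def)
    ultimately show ?thesis
      by (intro mult_left_mono) auto
  qed
  \<comment> \<open>Multiplying by \<open>exp (- \<omega> * T)\<close> undoes the weight and leaves
    the rate \<open>\<omega> - \<omega>'\<close>.\<close>
  finally have "exp (- \<omega> * T) * (exp (\<omega> * T) * norm (U T)) \<le>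
      exp (- \<omega> * T) * (C * exp (\<gamma> + \<omega>' * T))"
    by (intro mult_left_mono) auto
  moreover have "exp (- \<omega> * T) * (exp (\<omega> * T) * norm (U T)) = norm (U T)"
    by (simp flip: mult.assoc exp_add)
  moreover have "exp (- \<omega> * T) * (C * exp (\<gamma> + \<omega>' * T)) =
      C * (exp \<gamma> * exp (- (\<omega> - \<omega>') * T))"
    by (simp add: algebra_simps flip: exp_add)
  ultimately show "norm (U T) \<le>
    M * exp \<gamma> *
      (norm (f 0) + exp (\<omega> * \<tau>bar) * K * norm B * (SUP s\<in>{-\<tau>bar..0}. norm (exp (\<omega> * s) *\<^sub>R f s)))
      * exp (- (\<omega> - \<omega>') * T)"
    unfolding C_def E_def F_def by (simp only: mult_ac)
qed

end
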